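(* Let $I$ be an open interval in $\mathbb{R}$. If $f\in S^1(I)$, then $\operatorname{Cont}(f^{\mathrm{sd}})$ is a dense $G_\delta$ subset of $I$. Moreover, $f$ is classically differentiable at every point of $\operatorname{Cont}(f^{\mathrm{sd}})$, and $f'=f^{\mathrm{sd}}$ on $\operatorname{Cont}(f^{\mathrm{sd}})$.
   Context: For an open interval $I\subset\mathbb{R}$, a function $f:I\to\mathbb{R}$ and a point $x\in I$, the specular derivative of $f$ at $x$ is $$f^{\mathrm{sd}}(x) := \lim_{h \searrow 0} \mathcal{A}(f(x + h) - f(x), f(x) - f(x - h), h)$$ (with $h>0$ small enough that $x\pm h\in I$), where $\mathcal{A}:\mathbb{R}\times\mathbb{R}\times(0,\infty)\to\mathbb{R}$ is $$\mathcal{A}(a, b, c) := \frac{a \sqrt{b^2 + c^2} + b \sqrt{a^2 + c^2}}{c \sqrt{a^2 + c^2} + c \sqrt{b^2 + c^2}}.$$ $f$ is specularly differentiable at $x$ if this limit exists as a finite real number, and specularly differentiable on $I$ if it is so at every point of $I$. $S^0(I)$ is the set of functions $f:I\to\mathbb{R}$ that are specularly differentiable on $I$, and $S^1(I):=C^0(I)\cap S^0(I)$, where $C^0(I)$ is the set of continuous real-valued functions on $I$. For $g:I\to\mathbb{R}$, $\operatorname{Cont}(g)$ is the set of points of $I$ at which $g$ is continuous. A subset of $I$ is a $G_\delta$ set in $I$ if it is a countable intersection of open subsets of $I$. *)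

theory Defs
  imports "HOL-Analysis.Analysis"
begin

text \<open>
  A function on an open interval \<open>I\<close> is represented by a total function of type
  \<open>real \<Rightarrow> real\<close>. Its values outside \<open>I\<close> are irrelevant: for \<open>x\<close> in the open set \<open>I\<close>, all of
  \<open>x + h\<close>, \<open>x\<close>, \<open>x - h\<close> lie in \<open>I\<close> for small \<open>h > 0\<close>, so the limits along \<open>at_right 0\<close> below
  depend only on the restriction of \<open>f\<close> to \<open>I\<close>.
\<close>

text \<open>Only meant for \<open>c > 0\<close>.\<close>

definition specular_A :: "real \<Rightarrow> real \<Rightarrow> real \<Rightarrow> real" where
  "specular_A a b c =
     (a * sqrt (b\<^sup>2 + c\<^sup>2) + b * sqrt (a\<^sup>2 + c\<^sup>2)) /
     (c * sqrt (a\<^sup>2 + c\<^sup>2) + c * sqrt (b\<^sup>2 + c\<^sup>2))"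

definition specularly_differentiable_at :: "(real \<Rightarrow> real) \<Rightarrow> real \<Rightarrow> bool" where
  "specularly_differentiable_at f x \<longleftrightarrow>
     (\<exists>L. ((\<lambda>h. specular_A (f (x + h) - f x) (f x - f (x - h)) h) \<longlongrightarrow> L) (at_right 0))"

text \<open>An unspecified value where \<open>f\<close> is not specularly differentiable.\<close>

definition specular_deriv :: "(real \<Rightarrow> real) \<Rightarrow> real \<Rightarrow> real" where
  "specular_deriv f x =
     Lim (at_right 0) (\<lambda>h. specular_A (f (x + h) - f x) (f x - f (x - h)) h)"

definition specular_S0 :: "real set \<Rightarrow> (real \<Rightarrow> real) set" where
  "specular_S0 I = {f. \<forall>x\<in>I. specularly_differentiable_at f x}"

definition specular_S1 :: "real set \<Rightarrow> (real \<Rightarrow> real) set" where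
  "specular_S1 I = {f. continuous_on I f} \<inter> specular_S0 I"

definition continuity_points :: "real set \<Rightarrow> (real \<Rightarrow> real) \<Rightarrow> real set" where
  "continuity_points I g = {x \<in> I. continuous (at x within I) g}"

end

theory Submission
  imports Defs
begin

text \<open>
  For \<open>c > 0\<close> the number \<^term>\<open>specular_A a b c\<close> is a weighted average, with positive weights, of
  the two slopes \<open>a / c\<close> and \<open>b / c\<close>. In particular it cannot exceed both of them; the proof
  rests on this property, on continuity and on oddness in \<open>(a, b)\<close>.

  It yields a mean value inequality: if \<open>f\<close> is continuous on \<open>[a, b]\<close> and its specular derivative
  exceeds \<open>m\<close> on \<open>(a, b)\<close>, then \<open>f b - f a \<ge> m * (b - a)\<close>
  (\<open>increment_ge_of_specular_quotient_limit_gt\<close>). Otherwise \<open>g x = f x - m * x\<close> has \<open>g b < k < g a\<close>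
  for some \<open>k\<close>, and at the last point \<open>s\<close> of the closure of \<open>{g > k}\<close> there are arbitrarily small
  \<open>h > 0\<close> for which both one-sided difference quotients of \<open>f\<close> with step \<open>h\<close> are at most \<open>m\<close>, so
  that the specular derivative at \<open>s\<close> is at most \<open>m\<close>. Near a point where the specular derivative
  is continuous, this inequality and its mirror image confine all difference quotients to a small
  interval around its value, which is differentiability.

  That there are many such points is a Baire category argument. Locally, the specular derivative is
  pointwise the limit of its difference quotients along a sequence of fixed step sizes, which are
  continuous functions of the base point. A pointwise limit of continuous functions has
  arbitrarily small oscillation on some open subset of any given nonempty open set
  (\<open>pointwise_limit_small_oscillation_on_open_subset\<close>). The continuity points of any function are the
  intersection of the open regions on which its oscillation is locally less than \<open>1 / (n + 1)\<close>,
  hence a \<open>G\<^sub>\<delta>\<close> set; here these regions are dense, so the intersection is dense as well.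
\<close>

section \<open>The specular mean of two slopes\<close>

abbreviation specular_quotient :: "(real \<Rightarrow> real) \<Rightarrow> real \<Rightarrow> real \<Rightarrow> real" where
  "specular_quotient f x h \<equiv> specular_A (f (x + h) - f x) (f x - f (x - h)) h"

lemma specular_A_denominator_pos:
  assumes "c > 0"
  shows "c * sqrt (a\<^sup>2 + c\<^sup>2) + c * sqrt (b\<^sup>2 + c\<^sup>2) > 0"
proof -
  have "x\<^sup>2 + c\<^sup>2 > 0" for x
    using assms by (simp add: sum_power2_gt_zero_iff)
  then show ?thesis
    using assms by (intro add_pos_pos mult_pos_pos) simp_all
qed

text \<open>The weights of \<open>a / c\<close> and \<open>b / c\<close> are proportional to \<open>sqrt (b\<^sup>2 + c\<^sup>2)\<close> and
  \<open>sqrt (a\<^sup>2 + c\<^sup>2)\<close>, and an average of two numbers that are at most \<open>m\<close> is at most \<open>m\<close>.\<close>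

lemma specular_A_le:
  assumes "c > 0" "a \<le> m * c" "b \<le> m * c"
  shows "specular_A a b c \<le> m"
proof -
  have "a * sqrt (b\<^sup>2 + c\<^sup>2) \<le> m * c * sqrt (b\<^sup>2 + c\<^sup>2)"
    and "b * sqrt (a\<^sup>2 + c\<^sup>2) \<le> m * c * sqrt (a\<^sup>2 + c\<^sup>2)"
    using assms by (auto intro!: mult_right_mono)
  then show ?thesis
    unfolding specular_A_def pos_divide_le_eq[OF specular_A_denominator_pos[OF assms(1)]]
    by (simp add: algebra_simps)
qed

lemma specular_A_minus: "specular_A (- a) (- b) c = - specular_A a b c"
proof -
  have "- a * sqrt (b\<^sup>2 + c\<^sup>2) + - b * sqrt (a\<^sup>2 + c\<^sup>2)
      = - (a * sqrt (b\<^sup>2 + c\<^sup>2) + b * sqrt (a\<^sup>2 + c\<^sup>2))"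
    by simp
  then show ?thesis
    unfolding specular_A_def by (simp only: power2_minus minus_divide_left)
qed

lemma continuous_on_specular_A:
  fixes u v :: "'a::topological_space \<Rightarrow> real"
  assumes "continuous_on S u" "continuous_on S v" "c > 0"
  shows "continuous_on S (\<lambda>x. specular_A (u x) (v x) c)"
proof -
  have "c * sqrt ((u x)\<^sup>2 + c\<^sup>2) + c * sqrt ((v x)\<^sup>2 + c\<^sup>2) \<noteq> 0" for x
    using specular_A_denominator_pos[OF \<open>c > 0\<close>, of "u x" "v x"] by linarith
  then show ?thesis
    unfolding specular_A_def by (intro continuous_intros assms ballI)
qed

lemma tendsto_specular_deriv:
  assumes "specularly_differentiable_at f x"
  shows "(specular_quotient f x \<longlongrightarrow> specular_deriv f x) (at_right 0)"
proof -
  obtain L where L: "(specular_quotient f x \<longlongrightarrow> L) (at_right 0)"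
    using assms unfolding specularly_differentiable_at_def by blast
  then have "specular_deriv f x = L"
    unfolding specular_deriv_def by (intro tendsto_Lim) simp_all
  with L show ?thesis by simp
qed

section \<open>A mean value inequality\<close>

text \<open>
  Subtracting a linear function does not commute with taking the specular mean, so the case
  \<open>m = 0\<close> does not directly give the general one. The function \<open>g x = f x - m * x\<close> below serves only to locate the
  point \<open>s\<close> at which the hypothesis fails; the quotients there are those of \<open>f\<close>.
\<close>

lemma increment_ge_of_specular_quotient_limit_gt:
  fixes f L :: "real \<Rightarrow> real"
  assumes "a < b" and contf: "continuous_on {a..b} f"
    and lim: "\<And>x. a < x \<Longrightarrow> x < b \<Longrightarrow> (specular_quotient f x \<longlongrightarrow> L x) (at_right 0)"
    and gt: "\<And>x. a < x \<Longrightarrow> x < b \<Longrightarrow> m < L x"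
  shows "m * (b - a) \<le> f b - f a"
proof (rule ccontr)
  assume neg: "\<not> m * (b - a) \<le> f b - f a"
  define g where "g = (\<lambda>x. f x - m * x)"
  have "g b < g a"
    using neg by (simp add: g_def algebra_simps)
  then obtain k where k: "g b < k" "k < g a"
    using dense by blast
  have contg: "continuous_on {a..b} g"
    unfolding g_def by (intro continuous_intros contf)
  define T where "T = {t \<in> {a..b}. k < g t}"
  define s where "s = Sup T"
  have "a \<in> T" using \<open>a < b\<close> k by (simp add: T_def)
  have bdd: "bdd_above T" by (auto simp: T_def bdd_above_def)
  have s: "s \<in> {a..b}"
    using \<open>a \<in> T\<close> bdd unfolding s_def
    by (auto intro: cSup_upper cSup_least simp: T_def)
  have above: "g t \<le> k" if "s < t" "t \<le> b" for t
  proof (rule ccontr)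
    assume "\<not> g t \<le> k"
    with that s have "t \<in> T" by (simp add: T_def)
    with cSup_upper[OF _ bdd] have "t \<le> s" by (simp add: s_def)
    with that show False by simp
  qed
  \<comment> \<open>By continuity, \<open>g s > k\<close> would put points to the right of \<open>s\<close> into \<open>T\<close>, and \<open>g s < k\<close>
    would keep \<open>T\<close> away from \<open>s\<close>.\<close>
  have near: "\<exists>d>0. \<forall>t\<in>{a..b}. \<bar>t - s\<bar> < d \<longrightarrow> \<bar>g t - g s\<bar> < e" if "e > 0" for e
    using contg s that unfolding continuous_on_iff dist_real_def by blast
  have "g s \<le> k"
  proof (rule ccontr)
    assume *: "\<not> g s \<le> k"
    then have "s < b" using s k by (cases "s = b") auto
    obtain d where d: "d > 0" "\<forall>t\<in>{a..b}. \<bar>t - s\<bar> < d \<longrightarrow> \<bar>g t - g s\<bar> < g s - k"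
      using near[of "g s - k"] * by auto
    define t where "t = min b (s + d / 2)"
    have "s < t" "t \<le> b" "\<bar>t - s\<bar> < d" using d \<open>s < b\<close> by (auto simp: t_def)
    then show False using d above[of t] s by fastforce
  qed
  have "k \<le> g s"
  proof (rule ccontr)
    assume *: "\<not> k \<le> g s"
    obtain d where d: "d > 0" "\<forall>t\<in>{a..b}. \<bar>t - s\<bar> < d \<longrightarrow> \<bar>g t - g s\<bar> < k - g s"
      using near[of "k - g s"] * by auto
    obtain t where t: "t \<in> T" "s - d < t"
      using less_cSup_iff[OF _ bdd, of "s - d"] \<open>a \<in> T\<close> d by (auto simp: s_def)
    moreover have "t \<le> s" using t cSup_upper[OF _ bdd] by (simp add: s_def)
    ultimately have "t \<in> {a..b}" "\<bar>t - s\<bar> < d" "k < g t"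
      by (auto simp: T_def)
    with d(2) have "\<bar>g t - g s\<bar> < k - g s" by blast
    with \<open>k < g t\<close> show False by linarith
  qed
  with \<open>g s \<le> k\<close> have gs: "g s = k" by simp
  then have s': "a < s" "s < b"
    using k s by (auto simp: order.order_iff_strict)
  have "\<forall>\<^sub>F h in at_right 0. m < specular_quotient f s h"
    using order_tendstoD(1)[OF lim gt] s' by blast
  then obtain d where d: "d > 0" "\<And>h. 0 < h \<Longrightarrow> h < d \<Longrightarrow> m < specular_quotient f s h"
    unfolding eventually_at_right_field by auto
  \<comment> \<open>Step to the left from \<open>s\<close> to a point of \<open>T\<close>; the bound \<open>b - s\<close> keeps the mirrored point
    \<open>s + h\<close> inside \<open>[a, b]\<close>, where \<open>g \<le> k\<close>.\<close>
  obtain t where t: "t \<in> T" "s - min d (b - s) < t"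
    using less_cSup_iff[OF _ bdd, of "s - min d (b - s)"] \<open>a \<in> T\<close> d s' by (auto simp: s_def)
  have "t \<le> s" using t cSup_upper[OF _ bdd] by (simp add: s_def)
  moreover have "k < g t" using t(1) by (simp add: T_def)
  then have "t \<noteq> s" using gs by blast
  ultimately have "t < s" by simp
  define h where "h = s - t"
  have h: "0 < h" "h < d" "s + h \<le> b" using t \<open>t < s\<close> by (simp_all add: h_def)
  have "g (s + h) \<le> g s" using above[of "s + h"] h gs by simp
  then have "f (s + h) - f s \<le> m * h" by (simp add: g_def algebra_simps)
  moreover have "g s \<le> g (s - h)" using \<open>k < g t\<close> gs by (simp add: h_def)
  then have "f s - f (s - h) \<le> m * h" by (simp add: g_def algebra_simps)
  ultimately have "specular_quotient f s h \<le> m"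
    by (intro specular_A_le h(1))
  with d(2)[OF h(1,2)] show False by simp
qed

lemma increment_le_of_specular_quotient_limit_less:
  fixes f L :: "real \<Rightarrow> real"
  assumes "a < b" and contf: "continuous_on {a..b} f"
    and lim: "\<And>x. a < x \<Longrightarrow> x < b \<Longrightarrow> (specular_quotient f x \<longlongrightarrow> L x) (at_right 0)"
    and less: "\<And>x. a < x \<Longrightarrow> x < b \<Longrightarrow> L x < m"
  shows "f b - f a \<le> m * (b - a)"
proof -
  have "specular_quotient (\<lambda>x. - f x) x h = - specular_quotient f x h" for x h
    using specular_A_minus[of "f (x + h) - f x" "f x - f (x - h)" h] by simp
  then have "(specular_quotient (\<lambda>x. - f x) x \<longlongrightarrow> - L x) (at_right 0)" if "a < x" "x < b" for x
    using tendsto_minus[OF lim[OF that]] by simp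
  then have "- m * (b - a) \<le> - f b - - f a"
    using assms
    by (intro increment_ge_of_specular_quotient_limit_gt[where L = "\<lambda>x. - L x"])
       (auto intro: continuous_intros)
  then show ?thesis by simp
qed

text \<open>
  All points between \<open>x\<close> and a nearby \<open>y\<close> have specular derivative within \<open>e / 2\<close> of the value at
  \<open>x\<close>, so the mean value inequalities bound the difference quotient between \<open>x\<close> and \<open>y\<close> by the
  same margin.
\<close>

lemma has_derivative_at_continuity_point_of_specular_deriv:
  assumes "open I" "f \<in> specular_S1 I" "x \<in> I"
    and cont: "continuous (at x) (specular_deriv f)"
  shows "(f has_field_derivative specular_deriv f x) (at x)"
proof -
  let ?L = "specular_deriv f"
  have contf: "continuous_on I f"
    and lim: "\<And>y. y \<in> I \<Longrightarrow> (specular_quotient f y \<longlongrightarrow> ?L y) (at_right 0)"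
    using assms(2) tendsto_specular_deriv by (auto simp: specular_S1_def specular_S0_def)
  show ?thesis
    unfolding has_field_derivative_iff LIM_eq
  proof (intro allI impI)
    fix e :: real assume "e > 0"
    obtain r where r: "r > 0" "ball x r \<subseteq> I"
      using assms openE by blast
    obtain s where s: "s > 0" "\<And>y. \<bar>y - x\<bar> < s \<Longrightarrow> \<bar>?L y - ?L x\<bar> < e / 2"
      using cont \<open>e > 0\<close> unfolding continuous_at_eps_delta dist_real_def
      by (meson half_gt_zero)
    define d where "d = min r s"
    have d: "y \<in> I \<and> ?L x - e / 2 < ?L y \<and> ?L y < ?L x + e / 2" if "\<bar>y - x\<bar> < d" for y
    proof -
      have "y \<in> ball x r" using that by (simp add: d_def dist_real_def abs_minus_commute)
      moreover have "\<bar>?L y - ?L x\<bar> < e / 2" using s(2) that by (simp add: d_def)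
      then have "?L x - e / 2 < ?L y" "?L y < ?L x + e / 2" by linarith+
      ultimately show ?thesis using r by blast
    qed
    have increment: "(?L x - e / 2) * (v - u) \<le> f v - f u \<and> f v - f u \<le> (?L x + e / 2) * (v - u)"
      if "u < v" "\<bar>u - x\<bar> < d" "\<bar>v - x\<bar> < d" for u v
    proof -
      have y: "y \<in> I" "?L x - e / 2 < ?L y" "?L y < ?L x + e / 2" if "u \<le> y" "y \<le> v" for y
      proof -
        have "\<bar>y - x\<bar> < d"
          using that \<open>\<bar>u - x\<bar> < d\<close> \<open>\<bar>v - x\<bar> < d\<close> by linarith
        from d[OF this] show "y \<in> I" "?L x - e / 2 < ?L y" "?L y < ?L x + e / 2" by blast+
      qed
      have cont_uv: "continuous_on {u..v} f"
        by (rule continuous_on_subset[OF contf]) (use y(1) in auto)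
      show ?thesis
      proof
        show "(?L x - e / 2) * (v - u) \<le> f v - f u"
          by (rule increment_ge_of_specular_quotient_limit_gt[OF \<open>u < v\<close> cont_uv lim])
             (use y in \<open>simp_all add: less_imp_le\<close>)
        show "f v - f u \<le> (?L x + e / 2) * (v - u)"
          by (rule increment_le_of_specular_quotient_limit_less[OF \<open>u < v\<close> cont_uv lim])
             (use y in \<open>simp_all add: less_imp_le\<close>)
      qed
    qed
    have "norm ((f y - f x) / (y - x) - ?L x) < e" if y: "y \<noteq> x" "\<bar>y - x\<bar> < d" for y
    proof -
      have d0: "\<bar>x - x\<bar> < d" using y by simp
      have "?L x - e / 2 \<le> (f y - f x) / (y - x) \<and> (f y - f x) / (y - x) \<le> ?L x + e / 2"
      proof (cases "x < y")
        case True
        then show ?thesis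
          using increment[OF True d0 y(2)] by (simp add: pos_le_divide_eq pos_divide_le_eq)
      next
        case False
        then have "y < x" using y by simp
        have "(f y - f x) / (y - x) = (f x - f y) / (x - y)"
          by (metis minus_diff_eq minus_divide_divide)
        then show ?thesis
          using increment[OF \<open>y < x\<close> y(2) d0] \<open>y < x\<close>
          by (simp add: pos_le_divide_eq pos_divide_le_eq)
      qed
      then show ?thesis using \<open>e > 0\<close> by (simp add: abs_less_iff)
    qed
    moreover have "d > 0" using r s by (simp add: d_def)
    ultimately show "\<exists>s>0. \<forall>y. y \<noteq> x \<and> norm (y - x) < s \<longrightarrow>
        norm ((f y - f x) / (y - x) - ?L x) < e"
      by auto
  qed
qed

section \<open>Oscillation and continuity points\<close>

text \<open>Every single \<open>U\<close> in this union has oscillation less than \<open>e\<close>; the union itself only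
  locally. Building it from open sets makes its openness immediate.\<close>

definition small_oscillation_region ::
    "'a::topological_space set \<Rightarrow> ('a \<Rightarrow> 'b::metric_space) \<Rightarrow> real \<Rightarrow> 'a set" where
  "small_oscillation_region S g e =
     \<Union>{U. openin (top_of_set S) U \<and> (\<forall>x\<in>U. \<forall>y\<in>U. dist (g x) (g y) < e)}"

lemma openin_small_oscillation_region:
  "openin (top_of_set S) (small_oscillation_region S g e)"
  unfolding small_oscillation_region_def by blast

lemma continuity_points_eq_Inter_small_oscillation_region:
  "continuity_points S g = (\<Inter>n. small_oscillation_region S g (inverse (real (Suc n))))"
proof (intro set_eqI iffI)
  fix x assume x: "x \<in> continuity_points S g"
  show "x \<in> (\<Inter>n. small_oscillation_region S g (inverse (real (Suc n))))"
  proof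
    fix n
    let ?e = "inverse (real (Suc n))"
    obtain d where d: "d > 0" "\<And>y. y \<in> S \<Longrightarrow> dist y x < d \<Longrightarrow> dist (g y) (g x) < ?e / 2"
      using x unfolding continuity_points_def continuous_within_eps_delta
      by (auto dest: spec[of _ "?e / 2"])
    have "\<forall>y\<in>S \<inter> ball x d. \<forall>z\<in>S \<inter> ball x d. dist (g y) (g z) < ?e"
    proof (intro ballI)
      fix y z assume "y \<in> S \<inter> ball x d" "z \<in> S \<inter> ball x d"
      then have "dist (g y) (g x) < ?e / 2" "dist (g z) (g x) < ?e / 2"
        using d(2)[of y] d(2)[of z] by (simp_all add: dist_commute)
      then show "dist (g y) (g z) < ?e" by (rule dist_triangle_half_l)
    qed
    then show "x \<in> small_oscillation_region S g ?e"
      using x d(1) unfolding small_oscillation_region_def continuity_points_def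
      by (auto intro!: exI[of _ "S \<inter> ball x d"] openin_open_Int)
  qed
next
  fix x assume x: "x \<in> (\<Inter>n. small_oscillation_region S g (inverse (real (Suc n))))"
  then have "x \<in> S"
    using openin_subset[OF openin_small_oscillation_region] by fastforce
  moreover have "\<exists>d>0. \<forall>y\<in>S. dist y x < d \<longrightarrow> dist (g y) (g x) < e" if e: "e > 0" for e
  proof -
    obtain n where n: "inverse (real (Suc n)) < e"
      using reals_Archimedean[OF e] by blast
    obtain U where U: "openin (top_of_set S) U" "x \<in> U"
        "\<forall>y\<in>U. \<forall>z\<in>U. dist (g y) (g z) < inverse (real (Suc n))"
      using x unfolding small_oscillation_region_def by blast
    obtain d where "d > 0" "\<And>y. y \<in> S \<Longrightarrow> dist y x < d \<Longrightarrow> y \<in> U"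
      using U(1,2) unfolding openin_euclidean_subtopology_iff by blast
    with U n show ?thesis by (meson less_trans)
  qed
  ultimately show "x \<in> continuity_points S g"
    by (simp add: continuity_points_def continuous_within_eps_delta)
qed

lemma gdelta_in_continuity_points:
  "gdelta_in (top_of_set S) (continuity_points S g)"
  unfolding continuity_points_eq_Inter_small_oscillation_region
proof (rule gdelta_in_Inter)
  fix T assume "T \<in> range (\<lambda>n. small_oscillation_region S g (inverse (real (Suc n))))"
  then show "gdelta_in (top_of_set S) T"
    by (auto simp only: intro!: open_imp_gdelta_in openin_small_oscillation_region)
qed simp_all

section \<open>Pointwise limits of continuous functions\<close>

text \<open>
  The closed sets \<open>E N\<close>, on which all \<open>G i\<close> with \<open>i \<ge> N\<close> agree up to a fixed error, exhaust \<open>W\<close>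
  because \<open>G n x\<close> is a Cauchy sequence for every \<open>x\<close>. By Baire, one of them has interior points, and
  near such a point \<open>g\<close> is uniformly close to the single continuous function \<open>G N\<close>.
\<close>

lemma pointwise_limit_small_oscillation_on_open_subset:
  fixes g :: "'a::euclidean_space \<Rightarrow> 'b::metric_space"
  assumes "open W" "W \<noteq> {}" "e > 0"
    and cont: "\<And>n. continuous_on W (G n)"
    and lim: "\<And>x. x \<in> W \<Longrightarrow> (\<lambda>n. G n x) \<longlonglongrightarrow> g x"
  obtains U where "open U" "U \<noteq> {}" "U \<subseteq> W" "\<forall>x\<in>U. \<forall>y\<in>U. dist (g x) (g y) < e"
proof -
  \<comment> \<open>The error \<open>e\<close> has to cover \<open>g\<close> against \<open>G N\<close> at two points (\<open>e / 5\<close> each) and the variation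
    of \<open>G N\<close> on a preimage of a ball of radius \<open>e / 5\<close> (at most \<open>2 * e / 5\<close>).\<close>
  define E where "E N = {x \<in> W. \<forall>i\<ge>N. \<forall>j\<ge>N. dist (G i x) (G j x) \<le> e / 5}" for N
  have closed: "closedin (top_of_set W) (E N)" for N
  proof -
    have "E N = W \<inter> (\<Inter>i\<in>{N..}. \<Inter>j\<in>{N..}. {x \<in> W. dist (G i x) (G j x) \<le> e / 5})"
      by (auto simp: E_def)
    moreover have "closedin (top_of_set W) {x \<in> W. dist (G i x) (G j x) \<le> e / 5}" for i j
      using continuous_closedin_preimage[OF continuous_on_dist[OF cont cont] closed_atMost,
          of i j "e / 5"]
      unfolding vimage_def Int_def by simp
    ultimately show ?thesis
      by (auto intro!: closedin_Int closedin_Inter)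
  qed
  have "(\<Union>N. E N) = W"
  proof
    show "W \<subseteq> (\<Union>N. E N)"
    proof
      fix x assume "x \<in> W"
      then have "Cauchy (\<lambda>n. G n x)" using lim convergent_Cauchy convergent_def by blast
      then obtain N where "\<forall>i\<ge>N. \<forall>j\<ge>N. dist (G i x) (G j x) < e / 5"
        using \<open>e > 0\<close> metric_CauchyD[of "\<lambda>n. G n x" "e / 5"] by auto
      with \<open>x \<in> W\<close> show "x \<in> (\<Union>N. E N)" unfolding E_def by (auto intro: less_imp_le)
    qed
  qed (auto simp: E_def)
  have "\<exists>N. (top_of_set W) interior_of E N \<noteq> {}"
  proof (rule ccontr)
    assume "\<not> ?thesis"
    then have "(top_of_set W) interior_of \<Union>(range E) = {}"
      using closed \<open>open W\<close>
      by (intro Baire_category_alt)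
         (auto intro: completely_metrizable_space_openin completely_metrizable_space_euclidean)
    moreover have "(top_of_set W) interior_of W = W"
      using interior_of_topspace[of "top_of_set W"] by simp
    ultimately show False using \<open>(\<Union>N. E N) = W\<close> \<open>W \<noteq> {}\<close> by simp
  qed
  then obtain N p where p: "p \<in> (top_of_set W) interior_of E N" by blast
  define V where "V = (top_of_set W) interior_of E N"
  have "openin (top_of_set W) V" "V \<subseteq> E N" "p \<in> V"
    using p by (simp_all add: V_def interior_of_subset)
  then have V: "open V" "V \<subseteq> E N" "p \<in> V" "V \<subseteq> W"
    using \<open>open W\<close> by (simp_all add: openin_open_eq)
  have close: "dist (g x) (G N x) \<le> e / 5" if "x \<in> V" for x
  proof (rule tendsto_upperbound)
    show "(\<lambda>n. dist (G n x) (G N x)) \<longlonglongrightarrow> dist (g x) (G N x)"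
      using lim that V by (intro tendsto_intros) auto
    show "\<forall>\<^sub>F n in sequentially. dist (G n x) (G N x) \<le> e / 5"
      using that V unfolding eventually_sequentially E_def by blast
  qed auto
  define U where "U = V \<inter> G N -` ball (G N p) (e / 5)"
  have "open U"
    unfolding U_def using V continuous_on_subset[OF cont]
    by (intro continuous_open_preimage) auto
  moreover have "p \<in> U" using V \<open>e > 0\<close> by (simp add: U_def)
  moreover have "U \<subseteq> W" using V by (auto simp: U_def)
  moreover have "dist (g x) (g y) < e" if "x \<in> U" "y \<in> U" for x y
  proof -
    have "dist (G N x) (G N y) < 2 * (e / 5)"
      using that dist_triangle_less_add[of "G N x" "G N p" "e / 5" "G N y" "e / 5"]
      by (auto simp: U_def dist_commute)
    moreover have "dist (g x) (g y) \<le> dist (g x) (G N x) + dist (G N x) (G N y) + dist (g y) (G N y)"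
      using dist_triangle[of "g x" "g y" "G N x"] dist_triangle[of "G N x" "g y" "G N y"]
      by (simp add: dist_commute)
    ultimately show ?thesis
      using close[of x] close[of y] that \<open>e > 0\<close> by (simp add: U_def)
  qed
  ultimately show ?thesis using that by blast
qed

text \<open>
  It suffices to approximate \<open>g\<close> on some open part \<open>W\<close> of each nonempty open \<open>V\<close>, with a sequence that may
  depend on \<open>V\<close>. This form fits difference quotients with a fixed step, which make sense only
  away from the boundary of \<open>S\<close>.
\<close>

lemma closure_of_continuity_points_locally_pointwise_limit:
  fixes g :: "real \<Rightarrow> real"
  assumes "open S"
    and loc: "\<And>V. open V \<Longrightarrow> V \<noteq> {} \<Longrightarrow> V \<subseteq> S \<Longrightarrow>
      \<exists>W G. open W \<and> W \<noteq> {} \<and> W \<subseteq> V \<and> (\<forall>n. continuous_on W (G n)) \<and>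
        (\<forall>x\<in>W. (\<lambda>n. G n x) \<longlonglongrightarrow> g x)"
  shows "(top_of_set S) closure_of (continuity_points S g) = S"
proof -
  have dense: "(top_of_set S) closure_of small_oscillation_region S g e = S" if "e > 0" for e :: real
  proof -
    have "\<exists>x. x \<in> small_oscillation_region S g e \<inter> V"
      if V: "openin (top_of_set S) V" "V \<noteq> {}" for V
    proof -
      have "open V" "V \<subseteq> S" using V(1) \<open>open S\<close> by (auto simp: openin_open_eq)
      then obtain W G where W: "open W" "W \<noteq> {}" "W \<subseteq> V" and cont: "\<And>n. continuous_on W (G n)"
        and lim: "\<And>x. x \<in> W \<Longrightarrow> (\<lambda>n. G n x) \<longlonglongrightarrow> g x"
        using loc V(2) by meson
      obtain U where U: "open U" "U \<noteq> {}" "U \<subseteq> W" "\<forall>x\<in>U. \<forall>y\<in>U. dist (g x) (g y) < e"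
        using pointwise_limit_small_oscillation_on_open_subset[OF W(1,2) \<open>e > 0\<close> cont lim] by metis
      have "openin (top_of_set S) U"
        using U W \<open>V \<subseteq> S\<close> \<open>open S\<close> by (auto simp: openin_open_eq)
      then have "U \<subseteq> small_oscillation_region S g e"
        using U unfolding small_oscillation_region_def by blast
      with U W show ?thesis by blast
    qed
    then have "(top_of_set S) closure_of small_oscillation_region S g e = topspace (top_of_set S)"
      unfolding dense_intersects_open by blast
    then show ?thesis by simp
  qed
  have "(top_of_set S) closure_of (\<Inter>n. small_oscillation_region S g (inverse (real (Suc n))))
      = topspace (top_of_set S)"
    using \<open>open S\<close> dense
    by (intro Baire_category)
       (auto intro: completely_metrizable_space_openin completely_metrizable_space_euclidean
         openin_small_oscillation_region)
  then show ?thesis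
    by (simp add: continuity_points_eq_Inter_small_oscillation_region)
qed

text \<open>
  On a ball of half the radius of one that fits into \<open>V\<close>, steps up to that half radius do not leave
  \<open>V\<close>, so each quotient with such a fixed step is continuous in the base point.
\<close>

lemma specular_deriv_locally_pointwise_limit:
  assumes "f \<in> specular_S1 I" "open V" "V \<noteq> {}" "V \<subseteq> I"
  shows "\<exists>W G. open W \<and> W \<noteq> {} \<and> W \<subseteq> V \<and> (\<forall>n. continuous_on W (G n)) \<and>
    (\<forall>x\<in>W. (\<lambda>n. G n x) \<longlonglongrightarrow> specular_deriv f x)"
proof -
  have contf: "continuous_on V f"
    and lim: "\<And>x. x \<in> V \<Longrightarrow> (specular_quotient f x \<longlongrightarrow> specular_deriv f x) (at_right 0)"
    using assms tendsto_specular_deriv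
    by (auto simp: specular_S1_def specular_S0_def intro: continuous_on_subset)
  obtain p where "p \<in> V" using assms by blast
  then obtain r where r: "r > 0" "ball p r \<subseteq> V" using \<open>open V\<close> openE by blast
  define W where "W = ball p (r / 2)"
  define h where "h n = r / 2 * inverse (real (Suc n))" for n
  have h: "0 < h n" "h n \<le> r / 2" for n
    using r by (auto simp: h_def field_simps)
  have sub: "x + h n \<in> V" "x - h n \<in> V" "x \<in> V" if "x \<in> W" for x n
  proof -
    have "\<bar>x - p\<bar> < r / 2" using that by (simp add: W_def dist_real_def abs_minus_commute)
    then have "\<bar>x + h n - p\<bar> < r" "\<bar>x - h n - p\<bar> < r" "\<bar>x - p\<bar> < r"
      using h[of n] r by linarith+
    then show "x + h n \<in> V" "x - h n \<in> V" "x \<in> V"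
      using r by (auto simp: subset_iff dist_real_def abs_minus_commute)
  qed
  have "continuous_on W (\<lambda>x. specular_quotient f x (h n))" for n
    using h sub
    by (intro continuous_on_specular_A continuous_intros continuous_on_compose2[OF contf]) auto
  moreover have "(\<lambda>n. specular_quotient f x (h n)) \<longlonglongrightarrow> specular_deriv f x" if "x \<in> W" for x
  proof (rule filterlim_compose[OF lim])
    show "x \<in> V" using sub that by blast
    have "h \<longlonglongrightarrow> 0"
      unfolding h_def using tendsto_mult_right_zero[OF LIMSEQ_inverse_real_of_nat] by blast
    then show "filterlim h (at_right 0) sequentially"
      using h by (intro tendsto_imp_filterlim_at_right always_eventually) auto
  qed
  moreover have "open W" "W \<noteq> {}" "W \<subseteq> V" using r sub by (auto simp: W_def)
  ultimately show ?thesis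
    by (intro exI[of _ W] exI[of _ "\<lambda>n x. specular_quotient f x (h n)"]) blast
qed

section \<open>Continuity points of the specular derivative\<close>

theorem theorem5p5:
  fixes I :: "real set" and f :: "real \<Rightarrow> real"
  assumes "open I" and "is_interval I"
    and "f \<in> specular_S1 I"
  shows "gdelta_in (top_of_set I) (continuity_points I (specular_deriv f))
       \<and> (top_of_set I) closure_of (continuity_points I (specular_deriv f)) = I
       \<and> (\<forall>x \<in> continuity_points I (specular_deriv f).
            f differentiable (at x) \<and> deriv f x = specular_deriv f x)"
proof (intro conjI ballI)
  show "gdelta_in (top_of_set I) (continuity_points I (specular_deriv f))"
    by (rule gdelta_in_continuity_points)
  show "(top_of_set I) closure_of (continuity_points I (specular_deriv f)) = I"
    using assms
    by (intro closure_of_continuity_points_locally_pointwise_limit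
          specular_deriv_locally_pointwise_limit)
next
  fix x assume "x \<in> continuity_points I (specular_deriv f)"
  then have "x \<in> I" "continuous (at x within I) (specular_deriv f)"
    by (simp_all add: continuity_points_def)
  then have "continuous (at x) (specular_deriv f)"
    using at_within_open[OF _ \<open>open I\<close>] by simp
  then have D: "(f has_field_derivative specular_deriv f x) (at x)"
    using assms \<open>x \<in> I\<close> by (intro has_derivative_at_continuity_point_of_specular_deriv)
  then show "f differentiable (at x)"
    by (rule differentiableI[OF has_field_derivative_imp_has_derivative])
  show "deriv f x = specular_deriv f x"
    using D by (rule DERIV_imp_deriv)
qed

end
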